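(* Let $I, S\subset\, ]0, +\infty[$ be intervals and suppose that the one-parameter family of functions $\xi_{s}\colon I\to \mathbb{R}$ $(s\in S)$ admits a representation $$\xi_{s}(x)= \frac{\Phi(f(s)x)}{g(s)}\qquad (x\in I,\ s\in S)$$ with some function $\Phi$ and nowhere zero functions $f$ and $g$. Suppose further that $\xi$ admits a representation of the form $$\xi_{s}(x)= u(x)+v(s)\qquad (x\in I,\ s\in S).$$ If the function $\Phi$ is measurable and philandering and $f$ is strictly monotonic, positive and continuous, then (a) either there exist real constants $\alpha, \beta, \gamma$ with $\alpha\neq 0$ such that $$u(x)= \alpha \ln(x)+\beta,\qquad v(s)= \alpha \ln(f(s))+\gamma\qquad (x\in I,\ s\in S)$$ and $$\xi_{s}(x)= \alpha \ln(f(s)x)+\beta +\gamma\qquad (x\in I,\ s\in S),$$ (b) or there exist real constants $\alpha, \beta, \gamma, \rho$ with $\alpha, \rho \neq 0$ such that $$u(x)= \alpha x^{\rho}-\beta,\qquad v(s)= \frac{\gamma}{f(s)^{\rho}}+\beta\qquad (x\in I,\ s\in S)$$ and $$\xi_{s}(x)= \alpha x^{\rho}+\frac{\gamma}{f(s)^{\rho}}\qquad (x\in I,\ s\in S).$$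
   Context: Every interval has positive length. A function is called philandering if it is not constant on any interval of positive length. The functions $u\colon I\to\mathbb{R}$, $v\colon S\to\mathbb{R}$, $f,g\colon S\to\mathbb{R}$ and $\Phi$ are real-valued, with $\Phi$ defined at all points $f(s)x$, $x\in I$, $s\in S$. *)

theory Defs
  imports "HOL-Analysis.Analysis"
begin

definition proper_interval :: "real set \<Rightarrow> bool" where
  "proper_interval T \<longleftrightarrow> is_interval T \<and> (\<exists>a\<in>T. \<exists>b\<in>T. a < b)"

definition philandering_on :: "real set \<Rightarrow> (real \<Rightarrow> real) \<Rightarrow> bool" where
  "philandering_on D F \<longleftrightarrow> (\<forall>T. T \<subseteq> D \<and> proper_interval T \<longrightarrow> \<not> F constant_on T)"

end

theory Submission
  imports Defs
begin

text \<open>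
  In the coordinates \<open>y = ln x\<close> and \<open>p = ln (f s)\<close>, which range over proper intervals \<open>J\<close> and
  \<open>K\<close>, the two representations of \<open>\<xi>\<close> combine to
  \<open>\<phi> (p + y) = G p * (U y + V p)\<close>, where \<open>\<phi> = \<Phi> \<circ> exp\<close>, \<open>G\<close> has no zero, and \<open>U\<close> is not constant on any proper subinterval
  of \<open>J\<close>. The left-hand side does not change when a small \<open>h\<close> is moved from \<open>p\<close> to \<open>y\<close>; this is
  the only source of information.

  Moving \<open>h\<close> and subtracting the equations for two points at which \<open>U\<close> differs eliminates \<open>V\<close>
  and shows that \<open>G (p + h) / G p\<close> depends on \<open>h\<close> alone. Moreover \<open>G\<close> is a multiple of
  \<open>p \<mapsto> \<phi> (p + y) - \<phi> (p + z)\<close>, hence measurable. So \<open>ln \<bar>G\<bar>\<close> is a measurable function whose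
  increments do not depend on the base point, and such a function is affine
  (\<open>measurable_increments_affine\<close>): it is bounded on more than three quarters of a short
  interval, this set meets its translate by any small \<open>h\<close>, so the increments are bounded, and
  bounded additive functions are linear. This gives \<open>G (p + h) = exp (\<kappa> * h) * G p\<close> for small \<open>h\<close>
  (\<open>factor_locally_exponential\<close>).

  With this \<open>G\<close>, the equation becomes \<open>U (y + h) = exp (\<kappa> * h) * U y + b h\<close> for small \<open>h\<close>. If
  \<open>\<kappa> = 0\<close>, then \<open>U\<close> has increments independent of the base point and is measurable, so it is affine,
  and so is \<open>V\<close>, with the same slope: this is the logarithmic case. If \<open>\<kappa> \<noteq> 0\<close>, performing two
  shifts in either order determines \<open>b\<close> up to a factor, whence \<open>U y = \<alpha> * exp (\<kappa> * y) - \<beta>\<close>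
  (\<open>affine_shift_recurrence\<close>), and \<open>V\<close> follows: this is the power case. The two intervals may
  have quite different lengths, so the equation only controls short shifts; all conclusions
  are therefore first drawn locally and then glued along the interval.
\<close>

section \<open>Gluing along an interval\<close>

text \<open>
  Shifts below a fixed length suffice to carry a relation along a whole interval, by connectedness.
\<close>

lemma uniformly_locally_constant_on_interval:
  fixes H :: "real \<Rightarrow> 'b"
  assumes T: "is_interval T" and "\<epsilon> > 0"
    and loc: "\<And>x y. x \<in> T \<Longrightarrow> y \<in> T \<Longrightarrow> \<bar>x - y\<bar> < \<epsilon> \<Longrightarrow> H x = H y"
    and "x \<in> T" "y \<in> T"
  shows "H x = H y"
proof (rule connected_local_const[of T])
  show "connected T" using T by (simp add: is_interval_connected_1)
  show "\<forall>a\<in>T. \<forall>\<^sub>F b in at a within T. H a = H b"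
  proof
    fix a assume "a \<in> T"
    then show "\<forall>\<^sub>F b in at a within T. H a = H b"
      unfolding eventually_at dist_real_def using loc \<open>\<epsilon> > 0\<close>
      by (metis abs_minus_commute)
  qed
qed (fact assms)+

lemma affine_of_local_slope:
  fixes H :: "real \<Rightarrow> real"
  assumes "is_interval T" and "\<epsilon> > 0"
    and slope: "\<And>x h. x \<in> T \<Longrightarrow> x + h \<in> T \<Longrightarrow> 0 \<le> h \<Longrightarrow> h < \<epsilon> \<Longrightarrow> H (x + h) - H x = m * h"
  shows "\<exists>c. \<forall>x\<in>T. H x = m * x + c"
proof -
  have loc: "H x - m * x = H y - m * y" if "x \<in> T" "y \<in> T" "\<bar>x - y\<bar> < \<epsilon>" for x y
  proof (cases "x \<le> y")
    case True
    then show ?thesis using slope[of x "y - x"] that by (simp add: algebra_simps)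
  next
    case False
    then show ?thesis using slope[of y "x - y"] that by (simp add: algebra_simps)
  qed
  have const: "H x - m * x = H y - m * y" if "x \<in> T" "y \<in> T" for x y
    by (rule uniformly_locally_constant_on_interval[OF assms(1,2), where H = "\<lambda>x. H x - m * x"])
      (fact loc that)+
  show ?thesis
  proof (cases "T = {}")
    case True
    then show ?thesis by simp
  next
    case False
    then obtain x0 where "x0 \<in> T" by auto
    have "H x = m * x + (H x0 - m * x0)" if "x \<in> T" for x
      using const[OF that \<open>x0 \<in> T\<close>] by linarith
    then show ?thesis by blast
  qed
qed

section \<open>Measurable solutions of the local Cauchy equation\<close>

lemma additive_on_segment_multiple:
  fixes d :: "real \<Rightarrow> real"
  assumes add: "\<And>x y. 0 \<le> x \<Longrightarrow> 0 \<le> y \<Longrightarrow> x + y \<le> c \<Longrightarrow> d (x + y) = d x + d y"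
    and "0 \<le> x" "real n * x \<le> c"
  shows "d (real n * x) = real n * d x"
  using assms(3)
proof (induction n)
  case 0
  then show ?case using add[of 0 0] by simp
next
  case (Suc n)
  have "real n * x \<le> c" using Suc.prems \<open>0 \<le> x\<close> by (simp add: algebra_simps)
  with Suc show ?case using add[of "real n * x" x] \<open>0 \<le> x\<close> by (simp add: algebra_simps)
qed

text \<open>
  After subtracting the linear function with the same value at \<open>c\<close>, the remaining additive
  function vanishes at every \<open>c / n\<close>, so it takes all its values on arbitrarily short initial
  segments, where boundedness together with \<open>e (k * r) = k * e r\<close> makes it arbitrarily small.
\<close>

lemma bounded_additive_on_segment_linear:
  fixes d :: "real \<Rightarrow> real"
  assumes "c > 0" "\<eta> > 0"
    and add: "\<And>x y. 0 \<le> x \<Longrightarrow> 0 \<le> y \<Longrightarrow> x + y \<le> c \<Longrightarrow> d (x + y) = d x + d y"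
    and bounded: "\<And>x. 0 \<le> x \<Longrightarrow> x \<le> \<eta> \<Longrightarrow> \<bar>d x\<bar> \<le> M"
    and "0 \<le> x" "x \<le> c"
  shows "d x = d c / c * x"
proof -
  define e where "e t = d t - d c / c * t" for t
  have e_add: "e (s + t) = e s + e t" if "0 \<le> s" "0 \<le> t" "s + t \<le> c" for s t
    using add[OF that] by (simp add: e_def algebra_simps flip: add_divide_distrib)
  note e_mult = additive_on_segment_multiple[of c e, OF e_add]
  have "e c = 0" using \<open>c > 0\<close> by (simp add: e_def)
  define M' where "M' = M + \<bar>d c / c\<bar> * \<eta>"
  have e_bd: "\<bar>e t\<bar> \<le> M'" if "0 \<le> t" "t \<le> \<eta>" for t
  proof -
    have "\<bar>d c / c * t\<bar> \<le> \<bar>d c / c\<bar> * \<eta>"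
      unfolding abs_mult by (rule mult_left_mono) (use that in auto)
    then show ?thesis using bounded[OF that] unfolding e_def M'_def by linarith
  qed
  obtain N :: nat where N: "real N > c / \<eta>" using reals_Archimedean2 by blast
  have "real N > 0" using N \<open>c > 0\<close> \<open>\<eta> > 0\<close> by (meson divide_pos_pos less_trans)
  have "N > 0" using \<open>real N > 0\<close> by simp
  have small: "real k * \<bar>e x\<bar> \<le> M'" if "k > 0" for k :: nat
  proof -
    (* e vanishes at w = c / n with n = k * N, so it only depends on the remainder r of x modulo w;
       that remainder can be multiplied by k without leaving the range where e is bounded. *)
    define n where "n = k * N"
    define w where "w = c / real n"
    have "n > 0" using that \<open>N > 0\<close> by (simp add: n_def)
    have "w > 0" using \<open>n > 0\<close> \<open>c > 0\<close> by (simp add: w_def)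
    have "real n * w = c" using \<open>n > 0\<close> by (simp add: w_def)
    moreover have "e (real n * w) = real n * e w"
      by (rule e_mult) (use \<open>real n * w = c\<close> \<open>w > 0\<close> in simp_all)
    ultimately have "e w = 0" using \<open>e c = 0\<close> \<open>n > 0\<close> by simp
    define m where "m = nat \<lfloor>x / w\<rfloor>"
    define r where "r = x - real m * w"
    have m: "real m \<le> x / w" "x / w < real m + 1"
      using \<open>0 \<le> x\<close> \<open>w > 0\<close> by (auto simp: m_def)
    have r: "0 \<le> r" "r < w" "real m * w \<le> x"
      using m \<open>w > 0\<close> by (auto simp: r_def field_simps)
    have "real m * w \<le> c" using r(3) \<open>x \<le> c\<close> by simp
    then have "e (real m * w) = real m * e w"
      by (intro e_mult) (use \<open>w > 0\<close> in simp_all)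
    then have "e (real m * w) = 0" using \<open>e w = 0\<close> by simp
    then have "e x = e r"
      using e_add[of "real m * w" r] r \<open>w > 0\<close> \<open>x \<le> c\<close> by (simp add: r_def)
    have "real k * w = c / real N" using that by (simp add: w_def n_def)
    also have "\<dots> < \<eta>" using N \<open>real N > 0\<close> \<open>\<eta> > 0\<close> by (simp add: field_simps)
    finally have "real k * w < \<eta>" .
    moreover have "real k * r \<le> real k * w" using r by (intro mult_left_mono) auto
    ultimately have "real k * r \<le> \<eta>" by simp
    have "real k * w \<le> real n * w"
      using \<open>N > 0\<close> \<open>w > 0\<close> by (intro mult_right_mono) (auto simp: n_def mult_le_cancel_left1 simp flip: of_nat_mult)
    then have "real k * r \<le> c"
      using \<open>real k * r \<le> real k * w\<close> \<open>real n * w = c\<close> by linarith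
    then have "e (real k * r) = real k * e r" using r(1) by (intro e_mult)
    moreover have "\<bar>e (real k * r)\<bar> \<le> M'" using e_bd \<open>real k * r \<le> \<eta>\<close> r(1) by simp
    ultimately show ?thesis using \<open>e x = e r\<close> by (metis abs_mult abs_of_nat)
  qed
  have "e x = 0"
  proof (rule ccontr)
    assume "e x \<noteq> 0"
    then obtain k :: nat where "real k > M' / \<bar>e x\<bar>" using reals_Archimedean2 by blast
    then have "real k * \<bar>e x\<bar> > M'" using \<open>e x \<noteq> 0\<close> by (simp add: field_simps)
    then have "real (Suc k) * \<bar>e x\<bar> > M'" by (simp add: algebra_simps add_pos_nonneg)
    with small[of "Suc k"] show False by simp
  qed
  then show ?thesis by (simp add: e_def)
qed

text \<open>
  The sublevel sets of \<open>\<bar>L\<bar>\<close> exhaust the interval, so by continuity of the measure from below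
  their measure comes as close to \<open>b - a\<close> as desired.
\<close>

lemma measurable_bounded_on_large_subset:
  fixes L :: "real \<Rightarrow> real"
  assumes "a < b" and L: "L \<in> borel_measurable (lebesgue_on {a..b})" and "\<theta> < b - a"
  obtains M where "{x \<in> {a..b}. \<bar>L x\<bar> \<le> M} \<in> lmeasurable"
    "measure lebesgue {x \<in> {a..b}. \<bar>L x\<bar> \<le> M} > \<theta>"
proof -
  define E where "E n = {x \<in> {a..b}. \<bar>L x\<bar> \<le> real n}" for n :: nat
  have E: "E n \<in> sets lebesgue" for n
  proof -
    have "E n = {x \<in> {a..b}. L x \<in> {- real n..real n}}" by (auto simp: E_def)
    also have "\<dots> \<in> sets (lebesgue_on {a..b})"
      by (rule borel_measurable_vimage_borel[THEN iffD1, rule_format, OF L]) simp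
    finally show ?thesis by (simp add: sets_restrict_space_iff)
  qed
  have U: "(\<Union>n. E n) = {a..b}"
    by (auto simp: E_def) (meson real_arch_simple)
  have "(\<lambda>n. measure lebesgue (E n)) \<longlonglongrightarrow> measure lebesgue (\<Union>n. E n)"
  proof (rule Lim_measure_incseq)
    show "incseq E" by (auto simp: E_def incseq_def)
    show "emeasure lebesgue (\<Union>n. E n) \<noteq> \<infinity>"
      unfolding U by (simp add: emeasure_lborel_Icc_eq)
  qed (use E in auto)
  then have "(\<lambda>n. measure lebesgue (E n)) \<longlonglongrightarrow> b - a" using U \<open>a < b\<close> by simp
  then have "\<forall>\<^sub>F n in sequentially. measure lebesgue (E n) > \<theta>"
    using \<open>\<theta> < b - a\<close> by (rule order_tendstoD)
  then obtain n where "measure lebesgue (E n) > \<theta>"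
    by (auto simp: eventually_sequentially)
  moreover have "E n \<in> lmeasurable"
    using E by (rule bounded_set_imp_lmeasurable[rotated]) 
      (auto simp: E_def intro: bounded_subset[of "{a..b}"])
  ultimately show thesis using that[of "real n"] by (simp add: E_def)
qed

text \<open>
  This is the regularity step: measurability becomes boundedness of the increments because a set
  filling most of an interval meets its small translates, so every small \<open>h\<close> is the difference
  of two points at which \<open>L\<close> is bounded by the same constant.
\<close>

lemma measurable_increments_affine:
  fixes L :: "real \<Rightarrow> real"
  assumes T: "proper_interval T" and L: "L \<in> borel_measurable (lebesgue_on T)" and "\<epsilon> > 0"
    and incr: "\<And>x y h. \<lbrakk>x \<in> T; x + h \<in> T; y \<in> T; y + h \<in> T; \<bar>h\<bar> < \<epsilon>\<rbrakk>
                \<Longrightarrow> L (x + h) - L x = L (y + h) - L y"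
  obtains m c where "\<And>x. x \<in> T \<Longrightarrow> L x = m * x + c"
proof -
  obtain a b' where ab': "a \<in> T" "b' \<in> T" "a < b'" and ivl: "is_interval T"
    using T unfolding proper_interval_def by blast
  (* the segment is shorter than \<epsilon>, so that the hypothesis applies to all shifts within it *)
  define b where "b = min b' (a + \<epsilon> / 2)"
  have "a < b" "b < a + \<epsilon>" "b \<le> b'" using ab' \<open>\<epsilon> > 0\<close> by (auto simp: b_def)
  have sub: "{a..b} \<subseteq> T"
    using \<open>b \<le> b'\<close> mem_is_interval_1_I[OF ivl ab'(1,2)] by auto
  define d where "d h = L (a + h) - L a" for h
  define c where "c = b - a"
  have "c > 0" "c < \<epsilon>" using \<open>a < b\<close> \<open>b < a + \<epsilon>\<close> by (auto simp: c_def)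
  have inT: "a + h \<in> T" if "0 \<le> h" "h \<le> c" for h
    using that sub by (auto simp: c_def)
  have d: "L (x + h) - L x = d h" if "x \<in> T" "x + h \<in> T" "0 \<le> h" "h \<le> c" for x h
    using incr[of x h a] inT[of h] that ab'(1) \<open>c < \<epsilon>\<close> by (simp add: d_def)
  have d_add: "d (x + y) = d x + d y" if "0 \<le> x" "0 \<le> y" "x + y \<le> c" for x y
    using d[of "a + x" y] inT[of x] inT[of "x + y"] that by (simp add: d_def add.assoc)
  have "L \<in> borel_measurable (lebesgue_on {a..b})"
    using L sub by (rule measurable_restrict_mono)
  moreover have "3/4 * c < b - a" using \<open>c > 0\<close> by (simp add: c_def)
  ultimately obtain M where "{x \<in> {a..b}. \<bar>L x\<bar> \<le> M} \<in> lmeasurable"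
    and "measure lebesgue {x \<in> {a..b}. \<bar>L x\<bar> \<le> M} > 3/4 * c"
    by (rule measurable_bounded_on_large_subset[OF \<open>a < b\<close>])
  moreover define E where "E = {x \<in> {a..b}. \<bar>L x\<bar> \<le> M}"
  ultimately have E: "E \<in> lmeasurable" and Em: "measure lebesgue E > 3/4 * c" by simp_all
  have d_bd: "\<bar>d h\<bar> \<le> 2 * M" if h: "0 \<le> h" "h \<le> c / 4" for h
  proof -
    (* two disjoint copies of E would have total measure above 3c/2 inside an interval of length 5c/4 *)
    have "E \<inter> (+) h ` E \<noteq> {}"
    proof
      assume disj: "E \<inter> (+) h ` E = {}"
      have "measure lebesgue (E \<union> (+) h ` E) = measure lebesgue E + measure lebesgue ((+) h ` E)"
        using fmeasurableD[OF E] fmeasurableD2[OF E] fmeasurableD[OF measurable_translation[OF E]]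
          fmeasurableD2[OF measurable_translation[OF E]] disj
        by (simp add: measure_Union)
      also have "\<dots> = 2 * measure lebesgue E" by (simp add: measure_translation)
      finally have "measure lebesgue (E \<union> (+) h ` E) > 3/2 * c" using Em by simp
      moreover have "measure lebesgue (E \<union> (+) h ` E) \<le> measure lebesgue {a..b + c/4}"
      proof (rule measure_mono_fmeasurable)
        show "E \<union> (+) h ` E \<subseteq> {a..b + c/4}" using h by (auto simp: E_def)
        show "E \<union> (+) h ` E \<in> sets lebesgue"
          using E measurable_translation[OF E] by (blast intro: fmeasurableD)
      qed auto
      moreover have "measure lebesgue {a..b + c/4} = 5/4 * c"
        using \<open>c > 0\<close> by (simp add: c_def field_simps)
      ultimately show False using \<open>c > 0\<close> by simp
    qed
    then obtain x where x: "x \<in> E" "x + h \<in> E" by (auto simp: add.commute)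
    then have "x \<in> T" "x + h \<in> T" using sub by (auto simp: E_def)
    then have "d h = L (x + h) - L x" using d[of x h] h \<open>c > 0\<close> by simp
    then show ?thesis using x by (auto simp: E_def)
  qed
  have linear: "d h = d c / c * h" if "0 \<le> h" "h \<le> c" for h
    by (rule bounded_additive_on_segment_linear[of c "c/4" d "2 * M"])
      (use \<open>c > 0\<close> d_add d_bd that in auto)
  have slope: "L (x + h) - L x = d c / c * h"
    if "x \<in> T" "x + h \<in> T" "0 \<le> h" "h < c" for x h
    using d[of x h] linear[of h] that by linarith
  have "\<exists>k. \<forall>x\<in>T. L x = d c / c * x + k"
    by (rule affine_of_local_slope[OF ivl \<open>c > 0\<close>]) (fact slope)
  then obtain k where k: "\<And>x. x \<in> T \<Longrightarrow> L x = d c / c * x + k" by blast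
  show thesis by (rule that[of "d c / c" k]) (fact k)
qed

section \<open>The equation in logarithmic coordinates\<close>

text \<open>
  For a segment of length \<open>4 * c\<close> in \<open>T\<close>, shifts below \<open>c\<close> keep its middle half inside, and two
  such shifts together keep its midpoint inside. The first conclusion provides a whole interval of
  points that can be shifted, on which a philandering function still takes two values; the last
  one provides the points at which two shifts can be performed in either order.
\<close>

lemma small_shift_inside:
  assumes "proper_interval T"
  obtains \<epsilon> where "\<epsilon> > 0"
    "\<And>h. \<bar>h\<bar> < \<epsilon> \<Longrightarrow> \<exists>T'\<subseteq>T. proper_interval T' \<and> (\<forall>y\<in>T'. y + h \<in> T)"
    "\<And>h. \<bar>h\<bar> < \<epsilon> \<Longrightarrow> \<exists>y\<in>T. y + h \<in> T"
    "\<And>h k. \<bar>h\<bar> < \<epsilon> \<Longrightarrow> \<bar>k\<bar> < \<epsilon> \<Longrightarrow> \<exists>y\<in>T. y + h \<in> T \<and> y + k \<in> T \<and> y + h + k \<in> T"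
proof -
  obtain a b where ab: "a \<in> T" "b \<in> T" "a < b" and ivl: "is_interval T"
    using assms unfolding proper_interval_def by blast
  have sub: "x \<in> T" if "a \<le> x" "x \<le> b" for x
    using mem_is_interval_1_I[OF ivl ab(1,2)] that by blast
  define c where "c = (b - a) / 4"
  have "c > 0" "b = a + 4 * c" using \<open>a < b\<close> by (auto simp: c_def field_simps)
  show thesis
  proof (rule that[of c])
    fix h :: real assume "\<bar>h\<bar> < c"
    show "\<exists>T'\<subseteq>T. proper_interval T' \<and> (\<forall>y\<in>T'. y + h \<in> T)"
    proof (intro exI[of _ "{a + c..b - c}"] conjI ballI)
      show "{a + c..b - c} \<subseteq> T" using \<open>c > 0\<close> by (auto intro!: sub)
      have "a + c < b - c" using \<open>c > 0\<close> \<open>b = a + 4 * c\<close> by simp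
      then show "proper_interval {a + c..b - c}"
        unfolding proper_interval_def by (meson atLeastAtMost_iff is_interval_cc less_imp_le order_refl)
      show "y + h \<in> T" if "y \<in> {a + c..b - c}" for y
        using that \<open>\<bar>h\<bar> < c\<close> by (intro sub) auto
    qed
    show "\<exists>y\<in>T. y + h \<in> T"
      using \<open>\<bar>h\<bar> < c\<close> \<open>b = a + 4 * c\<close>
      by (intro bexI[of _ "a + 2 * c"] conjI sub) auto
    fix k :: real assume "\<bar>k\<bar> < c"
    then show "\<exists>y\<in>T. y + h \<in> T \<and> y + k \<in> T \<and> y + h + k \<in> T"
      using \<open>\<bar>h\<bar> < c\<close> \<open>b = a + 4 * c\<close>
      by (intro bexI[of _ "a + 2 * c"] conjI sub) auto
  qed fact
qed

text \<open>
  The shifts commute. Applying those by \<open>h\<close> and \<open>k\<close> in both orders yields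
  \<open>b k * (exp (\<kappa> * h) - 1) = b h * (exp (\<kappa> * k) - 1)\<close>, so \<open>b h\<close> is a constant multiple \<open>\<beta>\<close> of
  \<open>exp (\<kappa> * h) - 1\<close>. Then \<open>U + \<beta>\<close> is merely scaled by shifts, and dividing by the exponential
  leaves a locally constant function.
\<close>

lemma affine_shift_recurrence:
  fixes U :: "real \<Rightarrow> real"
  assumes "proper_interval J" "\<epsilon> > 0" "\<kappa> \<noteq> 0"
    and shift: "\<And>y h. \<lbrakk>y \<in> J; y + h \<in> J; \<bar>h\<bar> < \<epsilon>\<rbrakk> \<Longrightarrow> U (y + h) = exp (\<kappa> * h) * U y + b h"
  obtains \<alpha> \<beta> where "\<And>y. y \<in> J \<Longrightarrow> U y = \<alpha> * exp (\<kappa> * y) - \<beta>"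
proof -
  obtain \<delta> where "\<delta> > 0" and four:
    "\<And>h k. \<bar>h\<bar> < \<delta> \<Longrightarrow> \<bar>k\<bar> < \<delta> \<Longrightarrow> \<exists>y\<in>J. y + h \<in> J \<and> y + k \<in> J \<and> y + h + k \<in> J"
    using small_shift_inside[OF assms(1)] by metis
  define \<eta> where "\<eta> = min \<delta> \<epsilon>"
  have "\<eta> > 0" using \<open>\<delta> > 0\<close> \<open>\<epsilon> > 0\<close> by (simp add: \<eta>_def)
  have comm: "b k * (exp (\<kappa> * h) - 1) = b h * (exp (\<kappa> * k) - 1)"
    if hk: "\<bar>h\<bar> < \<eta>" "\<bar>k\<bar> < \<eta>" for h k
  proof -
    obtain y where y: "y \<in> J" "y + h \<in> J" "y + k \<in> J" "y + h + k \<in> J"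
      using four[of h k] hk by (auto simp: \<eta>_def)
    have "U (y + h + k) = exp (\<kappa> * k) * (exp (\<kappa> * h) * U y + b h) + b k"
      using shift[of "y + h" k] shift[of y h] y hk by (simp add: \<eta>_def)
    moreover have "U (y + k + h) = exp (\<kappa> * h) * (exp (\<kappa> * k) * U y + b k) + b h"
      using shift[of "y + k" h] shift[of y k] y hk by (simp add: \<eta>_def add_ac)
    moreover have "y + h + k = y + k + h" by simp
    ultimately show ?thesis by (simp add: algebra_simps)
  qed
  define k where "k = \<eta> / 2"
  have k: "\<bar>k\<bar> < \<eta>" "exp (\<kappa> * k) \<noteq> 1" using \<open>\<eta> > 0\<close> \<open>\<kappa> \<noteq> 0\<close> by (auto simp: k_def)
  define \<beta> where "\<beta> = b k / (exp (\<kappa> * k) - 1)"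
  have b: "b h = \<beta> * (exp (\<kappa> * h) - 1)" if "\<bar>h\<bar> < \<eta>" for h
    using comm[OF that k(1)] k(2) by (simp add: \<beta>_def field_simps)
  have scale: "U (y + h) + \<beta> = exp (\<kappa> * h) * (U y + \<beta>)"
    if "y \<in> J" "y + h \<in> J" "\<bar>h\<bar> < \<eta>" for y h
    using shift[OF that(1,2)] b[OF that(3)] that(3) by (simp add: \<eta>_def algebra_simps)
  have loc: "exp (- \<kappa> * x) * (U x + \<beta>) = exp (- \<kappa> * y) * (U y + \<beta>)"
    if "x \<in> J" "y \<in> J" "\<bar>x - y\<bar> < \<eta>" for x y
  proof -
    have "exp (- \<kappa> * x) * (U x + \<beta>) = (exp (- \<kappa> * x) * exp (\<kappa> * (x - y))) * (U y + \<beta>)"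
      using scale[of y "x - y"] that by simp
    also have "exp (- \<kappa> * x) * exp (\<kappa> * (x - y)) = exp (- \<kappa> * y)"
      by (simp add: algebra_simps flip: exp_add)
    finally show ?thesis .
  qed
  obtain y0 where "y0 \<in> J" and "is_interval J"
    using assms(1) unfolding proper_interval_def by blast
  define \<alpha> where "\<alpha> = exp (- \<kappa> * y0) * (U y0 + \<beta>)"
  have "U y = \<alpha> * exp (\<kappa> * y) - \<beta>" if "y \<in> J" for y
  proof -
    have "exp (- \<kappa> * y) * (U y + \<beta>) = \<alpha>"
      unfolding \<alpha>_def
      by (rule uniformly_locally_constant_on_interval[OF \<open>is_interval J\<close> \<open>\<eta> > 0\<close>,
            where H = "\<lambda>y. exp (- \<kappa> * y) * (U y + \<beta>)"]) (fact loc that \<open>y0 \<in> J\<close>)+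
    then show ?thesis by (simp add: exp_minus field_simps)
  qed
  then show thesis by (rule that)
qed

text \<open>
  Since \<open>U\<close> is not constant on the points of \<open>J\<close> that can be shifted inside \<open>J\<close>, differences of the
  equation isolate \<open>G (p + h) / G p\<close> as a quotient that does not involve \<open>p\<close>. The logarithm only
  sees \<open>\<bar>G\<bar>\<close>; the sign of \<open>G\<close> is controlled by midpoints, because \<open>G (p + h) * G p\<close> is the square
  of \<open>G (p + h / 2)\<close>.
\<close>

lemma factor_locally_exponential:
  fixes \<phi> U V G :: "real \<Rightarrow> real"
  assumes J: "proper_interval J" and K: "proper_interval K"
    and eq: "\<And>p y. p \<in> K \<Longrightarrow> y \<in> J \<Longrightarrow> \<phi> (p + y) = G p * (U y + V p)"
    and G: "\<And>p. p \<in> K \<Longrightarrow> G p \<noteq> 0"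
    and U: "\<And>T. T \<subseteq> J \<Longrightarrow> proper_interval T \<Longrightarrow> \<not> U constant_on T"
    and meas: "\<And>y. y \<in> J \<Longrightarrow> (\<lambda>p. \<phi> (p + y)) \<in> borel_measurable (lebesgue_on K)"
  shows "\<exists>\<kappa>. \<exists>\<epsilon>>0. \<forall>p h. p \<in> K \<longrightarrow> p + h \<in> K \<longrightarrow> \<bar>h\<bar> < \<epsilon> \<longrightarrow> G (p + h) = exp (\<kappa> * h) * G p"
proof -
  obtain \<epsilon> where "\<epsilon> > 0" and
    sub: "\<And>h. \<bar>h\<bar> < \<epsilon> \<Longrightarrow> \<exists>T'\<subseteq>J. proper_interval T' \<and> (\<forall>y\<in>T'. y + h \<in> J)"
    using small_shift_inside[OF J] by metis
  have cross: "G (p + h) * G q = G (q + h) * G p"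
    if "p \<in> K" "p + h \<in> K" "q \<in> K" "q + h \<in> K" "\<bar>h\<bar> < \<epsilon>" for p q h
  proof -
    obtain T where T: "T \<subseteq> J" "proper_interval T" "\<And>y. y \<in> T \<Longrightarrow> y - h \<in> J"
      using sub[of "- h"] \<open>\<bar>h\<bar> < \<epsilon>\<close> by auto
    from U[OF T(1,2)] obtain y z where yz: "y \<in> T" "z \<in> T" "U y \<noteq> U z"
      unfolding constant_on_def by metis
    have jump: "G (r + h) * (U (y - h) - U (z - h)) = G r * (U y - U z)"
      if "r \<in> K" "r + h \<in> K" for r
    proof -
      have "G (r + h) * (U (x - h) + V (r + h)) = G r * (U x + V r)" if "x \<in> T" for x
        using eq[of r x] eq[of "r + h" "x - h"] T that \<open>r \<in> K\<close> \<open>r + h \<in> K\<close>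
        by (auto simp: subset_iff)
      from this[OF yz(1)] this[OF yz(2)] show ?thesis by (simp add: algebra_simps)
    qed
    define A B where "A = U (y - h) - U (z - h)" and "B = U y - U z"
    have p: "G (p + h) * A = G p * B" and q: "G (q + h) * A = G q * B" and "B \<noteq> 0"
      using jump that yz(3) by (auto simp: A_def B_def)
    have "G (p + h) * G q * B = G (q + h) * (G (p + h) * A)"
      by (simp only: mult.assoc mult.left_commute flip: q)
    also have "\<dots> = G (q + h) * G p * B" by (simp only: p mult.assoc)
    finally show ?thesis using \<open>B \<noteq> 0\<close> by simp
  qed
  have "G \<in> borel_measurable (lebesgue_on K)"
  proof -
    obtain y z where yz: "y \<in> J" "z \<in> J" "U y \<noteq> U z"
      using U[OF order_refl J] unfolding constant_on_def by metis
    have "(\<lambda>p. (\<phi> (p + y) - \<phi> (p + z)) / (U y - U z)) \<in> borel_measurable (lebesgue_on K)"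
      using meas[OF yz(1)] meas[OF yz(2)] by measurable
    moreover have "(\<phi> (p + y) - \<phi> (p + z)) / (U y - U z) = G p" if "p \<in> space (lebesgue_on K)" for p
      using that yz eq by (simp add: field_simps)
    ultimately show ?thesis by (rule measurable_cong[THEN iffD1, rotated])
  qed
  then have meas_L: "(\<lambda>p. ln \<bar>G p\<bar>) \<in> borel_measurable (lebesgue_on K)" by measurable
  have "ln \<bar>G (p + h)\<bar> - ln \<bar>G p\<bar> = ln \<bar>G (q + h)\<bar> - ln \<bar>G q\<bar>"
    if "p \<in> K" "p + h \<in> K" "q \<in> K" "q + h \<in> K" "\<bar>h\<bar> < \<epsilon>" for p q h
  proof -
    have "\<bar>G (p + h)\<bar> * \<bar>G q\<bar> = \<bar>G (q + h)\<bar> * \<bar>G p\<bar>"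
      using cross[OF that] by (simp flip: abs_mult)
    then have "ln (\<bar>G (p + h)\<bar> * \<bar>G q\<bar>) = ln (\<bar>G (q + h)\<bar> * \<bar>G p\<bar>)" by simp
    then show ?thesis using G that by (simp add: ln_mult)
  qed
  from measurable_increments_affine[OF K meas_L \<open>\<epsilon> > 0\<close> this]
  obtain \<kappa> c where aff: "\<And>p. p \<in> K \<Longrightarrow> ln \<bar>G p\<bar> = \<kappa> * p + c" by blast
  have absG: "\<bar>G p\<bar> = exp (\<kappa> * p + c)" if "p \<in> K" for p
    using aff[OF that] G[OF that] by (metis exp_ln zero_less_abs_iff)
  have "G (p + h) = exp (\<kappa> * h) * G p" if p: "p \<in> K" "p + h \<in> K" "\<bar>h\<bar> < \<epsilon>" for p h
  proof -
    have "is_interval K" using K by (simp add: proper_interval_def)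
    have "p + h / 2 \<in> K"
    proof (cases "h \<ge> 0")
      case True
      then show ?thesis using mem_is_interval_1_I[OF \<open>is_interval K\<close> p(1,2)] by simp
    next
      case False
      then show ?thesis using mem_is_interval_1_I[OF \<open>is_interval K\<close> p(2,1)] by simp
    qed
    then have "G (p + h) * G p = G (p + h / 2) * G (p + h / 2)"
      using cross[of "p + h / 2" "h / 2" p] p by (simp add: add.commute)
    then have pos: "G (p + h) * G p > 0"
      using G[OF \<open>p + h / 2 \<in> K\<close>] by (metis not_real_square_gt_zero)
    have "\<bar>G (p + h)\<bar> = exp (\<kappa> * h) * \<bar>G p\<bar>"
      unfolding absG[OF p(1)] absG[OF p(2)] by (simp add: algebra_simps flip: exp_add)
    with pos show ?thesis by (auto simp: zero_less_mult_iff)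
  qed
  with \<open>\<epsilon> > 0\<close> show ?thesis by blast
qed

text \<open>
  Once the ratios of \<open>G\<close> are known, the equation links \<open>U\<close> and \<open>V\<close> only through their shifts, and
  whatever is established for the shifts of \<open>U\<close> carries over to those of \<open>V\<close>.
\<close>

theorem additive_separation:
  fixes \<phi> U V G :: "real \<Rightarrow> real"
  assumes J: "proper_interval J" and K: "proper_interval K"
    and eq: "\<And>p y. p \<in> K \<Longrightarrow> y \<in> J \<Longrightarrow> \<phi> (p + y) = G p * (U y + V p)"
    and G: "\<And>p. p \<in> K \<Longrightarrow> G p \<noteq> 0"
    and U: "\<And>T. T \<subseteq> J \<Longrightarrow> proper_interval T \<Longrightarrow> \<not> U constant_on T"
    and meas_K: "\<And>y. y \<in> J \<Longrightarrow> (\<lambda>p. \<phi> (p + y)) \<in> borel_measurable (lebesgue_on K)"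
    and meas_J: "\<And>p. p \<in> K \<Longrightarrow> (\<lambda>y. \<phi> (p + y)) \<in> borel_measurable (lebesgue_on J)"
  obtains
    (affine) \<alpha> \<beta> \<gamma> where "\<alpha> \<noteq> 0" "\<And>y. y \<in> J \<Longrightarrow> U y = \<alpha> * y + \<beta>"
      "\<And>p. p \<in> K \<Longrightarrow> V p = \<alpha> * p + \<gamma>"
  | (exponential) \<alpha> \<beta> \<gamma> \<rho> where "\<alpha> \<noteq> 0" "\<rho> \<noteq> 0"
      "\<And>y. y \<in> J \<Longrightarrow> U y = \<alpha> * exp (\<rho> * y) - \<beta>"
      "\<And>p. p \<in> K \<Longrightarrow> V p = \<gamma> * exp (- \<rho> * p) + \<beta>"
proof -
  have "\<exists>\<kappa>. \<exists>\<epsilon>>0. \<forall>p h. p \<in> K \<longrightarrow> p + h \<in> K \<longrightarrow> \<bar>h\<bar> < \<epsilon> \<longrightarrow> G (p + h) = exp (\<kappa> * h) * G p"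
    by (rule factor_locally_exponential[where \<phi> = \<phi> and U = U and V = V and J = J])
      (fact J K eq G U meas_K)+
  then obtain \<kappa> \<epsilon> where "\<epsilon> > 0" and expG:
    "\<And>p h. \<lbrakk>p \<in> K; p + h \<in> K; \<bar>h\<bar> < \<epsilon>\<rbrakk> \<Longrightarrow> G (p + h) = exp (\<kappa> * h) * G p"
    by blast
  have transfer: "exp (\<kappa> * h) * (U y + V (p + h)) = U (y + h) + V p"
    if "p \<in> K" "p + h \<in> K" "y \<in> J" "y + h \<in> J" "\<bar>h\<bar> < \<epsilon>" for p h y
  proof -
    have "G (p + h) * (U y + V (p + h)) = G p * (U (y + h) + V p)"
      using eq[of "p + h" y] eq[of p "y + h"] that by (simp add: add_ac)
    then show ?thesis using expG[OF that(1,2,5)] G[OF that(1)] by simp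
  qed
  obtain \<delta>J where "\<delta>J > 0" and inJ: "\<And>h. \<bar>h\<bar> < \<delta>J \<Longrightarrow> \<exists>y\<in>J. y + h \<in> J"
    using small_shift_inside[OF J] by metis
  obtain \<delta>K where "\<delta>K > 0" and inK: "\<And>h. \<bar>h\<bar> < \<delta>K \<Longrightarrow> \<exists>p\<in>K. p + h \<in> K"
    using small_shift_inside[OF K] by metis
  define \<eta> where "\<eta> = min \<epsilon> (min \<delta>J \<delta>K)"
  have "\<eta> > 0" "\<eta> \<le> \<epsilon>" "\<eta> \<le> \<delta>J" "\<eta> \<le> \<delta>K"
    using \<open>\<epsilon> > 0\<close> \<open>\<delta>J > 0\<close> \<open>\<delta>K > 0\<close> by (auto simp: \<eta>_def)
  have ivlJ: "is_interval J" and ivlK: "is_interval K"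
    using J K by (auto simp: proper_interval_def)
  obtain p0 where "p0 \<in> K" using K by (auto simp: proper_interval_def)
  have nonconst: "\<not> U constant_on J" using U[OF order_refl J] .
  show thesis
  proof (cases "\<kappa> = 0")
    case True
    have step: "U (y + h) - U y = V (p + h) - V p"
      if "p \<in> K" "p + h \<in> K" "y \<in> J" "y + h \<in> J" "\<bar>h\<bar> < \<eta>" for p h y
      using transfer[of p h y] that True \<open>\<eta> \<le> \<epsilon>\<close> by simp
    have incr: "U (x + h) - U x = U (y + h) - U y"
      if xy: "x \<in> J" "x + h \<in> J" "y \<in> J" "y + h \<in> J" and h: "\<bar>h\<bar> < \<eta>" for x y h
    proof -
      obtain p where "p \<in> K" "p + h \<in> K" using inK[of h] h \<open>\<eta> \<le> \<delta>K\<close> by fastforce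
      then show ?thesis using step[of p h x] step[of p h y] xy h by simp
    qed
    have "(\<lambda>y. \<phi> (p0 + y) / G p0 - V p0) \<in> borel_measurable (lebesgue_on J)"
      using meas_J[OF \<open>p0 \<in> K\<close>] by measurable
    moreover have "\<phi> (p0 + y) / G p0 - V p0 = U y" if "y \<in> space (lebesgue_on J)" for y
      using that eq[OF \<open>p0 \<in> K\<close>] G[OF \<open>p0 \<in> K\<close>] by simp
    ultimately have "U \<in> borel_measurable (lebesgue_on J)"
      by (rule measurable_cong[THEN iffD1, rotated])
    from measurable_increments_affine[OF J this \<open>\<eta> > 0\<close> incr]
    obtain \<alpha> \<beta> where aff: "\<And>y. y \<in> J \<Longrightarrow> U y = \<alpha> * y + \<beta>" by blast
    have slope: "V (p + h) - V p = \<alpha> * h"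
      if p: "p \<in> K" "p + h \<in> K" and h: "0 \<le> h" "h < \<eta>" for p h
    proof -
      obtain y where "y \<in> J" "y + h \<in> J" using inJ[of h] h \<open>\<eta> \<le> \<delta>J\<close> by fastforce
      then show ?thesis using step[of p h y] p h aff by (simp add: algebra_simps)
    qed
    have "\<exists>\<gamma>. \<forall>p\<in>K. V p = \<alpha> * p + \<gamma>"
      by (rule affine_of_local_slope[OF ivlK \<open>\<eta> > 0\<close>]) (fact slope)
    then obtain \<gamma> where affV: "\<And>p. p \<in> K \<Longrightarrow> V p = \<alpha> * p + \<gamma>" by blast
    have "\<alpha> \<noteq> 0" using nonconst aff unfolding constant_on_def by auto
    then show thesis by (rule affine[of \<alpha> \<beta> \<gamma>]) (fact aff affV)+
  next
    case False
    have step: "U (y + h) = exp (\<kappa> * h) * U y + (exp (\<kappa> * h) * V (p + h) - V p)"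
      if "p \<in> K" "p + h \<in> K" "y \<in> J" "y + h \<in> J" "\<bar>h\<bar> < \<eta>" for p h y
      using transfer[of p h y] that \<open>\<eta> \<le> \<epsilon>\<close> by (simp add: algebra_simps)
    (* the equation shows that the remainder b h of a shift does not depend on the point of K
       chosen to express it, so any choice of that point will do *)
    define P where "P h = (SOME p. p \<in> K \<and> p + h \<in> K)" for h
    define b where "b h = exp (\<kappa> * h) * V (P h + h) - V (P h)" for h
    have "U (y + h) = exp (\<kappa> * h) * U y + b h" if "y \<in> J" "y + h \<in> J" "\<bar>h\<bar> < \<eta>" for y h
    proof -
      have "\<exists>p. p \<in> K \<and> p + h \<in> K" using inK[of h] that \<open>\<eta> \<le> \<delta>K\<close> by fastforce
      then have "P h \<in> K \<and> P h + h \<in> K" unfolding P_def by (rule someI_ex)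
      then show ?thesis unfolding b_def using step[of "P h" h y] that by simp
    qed
    from affine_shift_recurrence[OF J \<open>\<eta> > 0\<close> False this]
    obtain \<alpha> \<beta> where expU: "\<And>y. y \<in> J \<Longrightarrow> U y = \<alpha> * exp (\<kappa> * y) - \<beta>" by blast
    have loc: "exp (\<kappa> * p) * (V p - \<beta>) = exp (\<kappa> * q) * (V q - \<beta>)"
      if pq: "p \<in> K" "q \<in> K" "\<bar>p - q\<bar> < \<eta>" for p q
    proof -
      define h where "h = p - q"
      have "\<bar>h\<bar> < \<delta>J" using pq \<open>\<eta> \<le> \<delta>J\<close> by (simp add: h_def)
      from inJ[OF this] obtain y where y: "y \<in> J" "y + h \<in> J" by blast
      have "U (y + h) = exp (\<kappa> * h) * U y + (exp (\<kappa> * h) * V p - V q)"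
        using step[of q h y] pq y by (simp add: h_def)
      moreover have "U (y + h) = exp (\<kappa> * h) * (U y + \<beta>) - \<beta>"
        using expU[OF y(1)] expU[OF y(2)] by (simp add: distrib_left exp_add)
      ultimately have "exp (\<kappa> * h) * (V p - \<beta>) = V q - \<beta>" by (simp add: algebra_simps)
      then have "exp (\<kappa> * q) * exp (\<kappa> * h) * (V p - \<beta>) = exp (\<kappa> * q) * (V q - \<beta>)" by simp
      also have "exp (\<kappa> * q) * exp (\<kappa> * h) = exp (\<kappa> * p)"
        by (simp add: h_def algebra_simps flip: exp_add)
      finally show ?thesis .
    qed
    define \<gamma> where "\<gamma> = exp (\<kappa> * p0) * (V p0 - \<beta>)"
    have expV: "V p = \<gamma> * exp (- \<kappa> * p) + \<beta>" if "p \<in> K" for p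
    proof -
      have "exp (\<kappa> * p) * (V p - \<beta>) = \<gamma>"
        unfolding \<gamma>_def
        by (rule uniformly_locally_constant_on_interval[OF ivlK \<open>\<eta> > 0\<close>,
              where H = "\<lambda>p. exp (\<kappa> * p) * (V p - \<beta>)"]) (fact loc that \<open>p0 \<in> K\<close>)+
      then show ?thesis by (simp add: exp_minus field_simps)
    qed
    have "\<alpha> \<noteq> 0" using nonconst expU unfolding constant_on_def by auto
    then show thesis using False by (rule exponential[of \<alpha> \<kappa> \<beta> \<gamma>]) (fact expU expV)+
  qed
qed

section \<open>Passing to logarithmic coordinates\<close>

text \<open>
  Lebesgue measurability, unlike Borel measurability, is not preserved by composition with an
  arbitrary homeomorphism. It is preserved here because the inverse is differentiable, and
  differentiable maps send Lebesgue sets to Lebesgue sets.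
\<close>

lemma borel_measurable_lebesgue_on_compose:
  fixes h k :: "real \<Rightarrow> real"
  assumes F: "F \<in> borel_measurable (lebesgue_on D)" and "h ` T \<subseteq> D"
    and "T \<in> sets lebesgue" "h ` T \<in> sets lebesgue"
    and k: "k differentiable_on h ` T" "\<And>t. t \<in> T \<Longrightarrow> k (h t) = t"
  shows "(\<lambda>t. F (h t) :: real) \<in> borel_measurable (lebesgue_on T)"
  unfolding borel_measurable_vimage_borel
proof (intro allI impI)
  fix B :: "real set" assume "B \<in> sets borel"
  define Z where "Z = {z \<in> h ` T. F z \<in> B}"
  have "F \<in> borel_measurable (lebesgue_on (h ` T))"
    using F \<open>h ` T \<subseteq> D\<close> by (rule measurable_restrict_mono)
  then have "Z \<in> sets (lebesgue_on (h ` T))"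
    unfolding Z_def borel_measurable_vimage_borel using \<open>B \<in> sets borel\<close> by (elim allE impE)
  then have Z: "Z \<in> sets lebesgue" "Z \<subseteq> h ` T"
    using \<open>h ` T \<in> sets lebesgue\<close> by (auto simp: sets_restrict_space_iff Z_def)
  have "k differentiable_on Z" using k(1) Z(2) by (rule differentiable_on_subset)
  then have "k ` Z \<in> sets lebesgue"
    using Z(1) by (intro differentiable_image_in_sets_lebesgue) auto
  moreover have "k ` Z = {t \<in> T. F (h t) \<in> B}" using k(2) by (force simp: Z_def)
  ultimately show "{t \<in> T. F (h t) \<in> B} \<in> sets (lebesgue_on T)"
    using \<open>T \<in> sets lebesgue\<close> by (simp add: sets_restrict_space_iff)
qed

lemma borel_measurable_in_log_coordinate:
  fixes F :: "real \<Rightarrow> real"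
  assumes F: "F \<in> borel_measurable (lebesgue_on D)" and "is_interval T" "r > 0"
    and D: "\<And>t. t \<in> T \<Longrightarrow> r * exp t \<in> D"
  shows "(\<lambda>t. F (r * exp t)) \<in> borel_measurable (lebesgue_on T)"
proof (rule borel_measurable_lebesgue_on_compose[OF F, where h = "\<lambda>t. r * exp t" and k = "\<lambda>z. ln (z / r)"])
  have interval_lebesgue: "A \<in> sets lebesgue" if "is_interval A" for A :: "real set"
    using real_interval_borel_measurable[OF that] by (intro sets_completionI_sets) simp
  have "is_interval ((\<lambda>t. r * exp t) ` T)"
    using \<open>is_interval T\<close> unfolding is_interval_connected_1
    by (intro connected_continuous_image continuous_intros)
  then show "(\<lambda>t. r * exp t) ` T \<in> sets lebesgue"
    by (rule interval_lebesgue)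
  show "T \<in> sets lebesgue"
    using \<open>is_interval T\<close> by (rule interval_lebesgue)
  have "(\<lambda>z. ln (z / r)) differentiable (at z)" if "z > 0" for z
  proof -
    have "((\<lambda>z. ln (z / r)) has_real_derivative 1 / z) (at z)"
      using that \<open>r > 0\<close> by (auto intro!: derivative_eq_intros simp: field_simps)
    then show ?thesis by (auto simp: real_differentiable_def)
  qed
  then show "(\<lambda>z. ln (z / r)) differentiable_on (\<lambda>t. r * exp t) ` T"
    using \<open>r > 0\<close> unfolding differentiable_on_def
    by (auto intro: differentiable_at_withinI)
  show "(\<lambda>t. r * exp t) ` T \<subseteq> D" using D by blast
qed (use \<open>r > 0\<close> in simp)

lemma proper_interval_image:
  assumes "proper_interval T" "continuous_on T h" "inj_on h T"
  shows "proper_interval (h ` T)"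
proof -
  obtain a b where "a \<in> T" "b \<in> T" "a < b" "is_interval T"
    using assms(1) unfolding proper_interval_def by blast
  then have "h a < h b \<or> h b < h a" using assms(3) unfolding inj_on_def by (metis less_irrefl linorder_neqE)
  moreover have "is_interval (h ` T)"
    using \<open>is_interval T\<close> assms(2) unfolding is_interval_connected_1 by (rule connected_continuous_image[rotated])
  ultimately show ?thesis using \<open>a \<in> T\<close> \<open>b \<in> T\<close> unfolding proper_interval_def by blast
qed

theorem proposition2:
  fixes I S :: "real set"
    and \<xi> :: "real \<Rightarrow> real \<Rightarrow> real"
    and \<Phi> f g u v :: "real \<Rightarrow> real"
  assumes "proper_interval I" and "I \<subseteq> {0<..}"
    and "proper_interval S" and "S \<subseteq> {0<..}"
    and "\<forall>s\<in>S. f s \<noteq> 0" and "\<forall>s\<in>S. g s \<noteq> 0"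
    and "\<forall>x\<in>I. \<forall>s\<in>S. \<xi> s x = \<Phi> (f s * x) / g s"
    and "\<forall>x\<in>I. \<forall>s\<in>S. \<xi> s x = u x + v s"
    and "\<Phi> \<in> borel_measurable (lebesgue_on {f s * x |s x. s \<in> S \<and> x \<in> I})"
    and "philandering_on {f s * x |s x. s \<in> S \<and> x \<in> I} \<Phi>"
    and "strict_mono_on S f \<or> strict_antimono_on S f"
    and "\<forall>s\<in>S. f s > 0"
    and "continuous_on S f"
  shows "(\<exists>\<alpha> \<beta> \<gamma> :: real. \<alpha> \<noteq> 0 \<and>
            (\<forall>x\<in>I. u x = \<alpha> * ln x + \<beta>) \<and>
            (\<forall>s\<in>S. v s = \<alpha> * ln (f s) + \<gamma>) \<and>
            (\<forall>x\<in>I. \<forall>s\<in>S. \<xi> s x = \<alpha> * ln (f s * x) + \<beta> + \<gamma>))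
       \<or> (\<exists>\<alpha> \<beta> \<gamma> \<rho> :: real. \<alpha> \<noteq> 0 \<and> \<rho> \<noteq> 0 \<and>
            (\<forall>x\<in>I. u x = \<alpha> * x powr \<rho> - \<beta>) \<and>
            (\<forall>s\<in>S. v s = \<gamma> / f s powr \<rho> + \<beta>) \<and>
            (\<forall>x\<in>I. \<forall>s\<in>S. \<xi> s x = \<alpha> * x powr \<rho> + \<gamma> / f s powr \<rho>))"
proof -
  note I = assms(1,2) and S = assms(3) and g0 = assms(6) and rep = assms(7) and sep = assms(8)
    and meas = assms(9) and phil = assms(10) and f_pos = assms(12) and f_cont = assms(13)
  define D where "D = {f s * x |s x. s \<in> S \<and> x \<in> I}"
  have D: "f s * x \<in> D" if "s \<in> S" "x \<in> I" for s x
    using that unfolding D_def by blast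
  have f_inj: "inj_on f S"
    using assms(11) strict_mono_on_imp_inj_on strict_antimono_iff_antimono[of S f]
    by (auto simp: monotone_on_def)
  define J where "J = ln ` I"
  define K where "K = (\<lambda>s. ln (f s)) ` S"
  have J: "proper_interval J"
    unfolding J_def
  proof (rule proper_interval_image[OF I(1)])
    show "continuous_on I ln" "inj_on ln I" using I(2) by (auto intro!: continuous_intros simp: inj_on_def subset_iff)
  qed
  have K: "proper_interval K"
    unfolding K_def
  proof (rule proper_interval_image[OF S])
    show "continuous_on S (\<lambda>s. ln (f s))" using f_cont f_pos by (intro continuous_intros) auto
    show "inj_on (\<lambda>s. ln (f s)) S" using f_inj f_pos by (auto simp: inj_on_def)
  qed
  have exp_I: "exp y \<in> I" if "y \<in> J" for y
    using that I(2) by (auto simp: J_def)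
  define \<sigma> where "\<sigma> p = inv_into S f (exp p)" for p
  have \<sigma>_f: "\<sigma> (ln (f s)) = s" if "s \<in> S" for s
    using that f_pos f_inj by (simp add: \<sigma>_def)
  have \<sigma>: "\<sigma> p \<in> S" "f (\<sigma> p) = exp p" if "p \<in> K" for p
    using that \<sigma>_f f_pos by (auto simp: K_def)
  define U where "U y = u (exp y)" for y
  define V where "V p = v (\<sigma> p)" for p
  define \<phi> where "\<phi> t = \<Phi> (exp t)" for t
  have u: "u x = U (ln x)" "ln x \<in> J" if "x \<in> I" for x
    using that I(2) by (auto simp: U_def J_def)
  have v: "v s = V (ln (f s))" "ln (f s) \<in> K" if "s \<in> S" for s
    using that \<sigma>_f by (auto simp: V_def K_def)
  have eq: "\<phi> (p + y) = g (\<sigma> p) * (U y + V p)" if "p \<in> K" "y \<in> J" for p y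
  proof -
    have "\<Phi> (f (\<sigma> p) * exp y) / g (\<sigma> p) = u (exp y) + v (\<sigma> p)"
      using rep sep \<sigma>(1)[OF that(1)] exp_I[OF that(2)] by metis
    then show ?thesis
      using g0 \<sigma>[OF that(1)] by (simp add: \<phi>_def U_def V_def exp_add field_simps)
  qed
  have g: "g (\<sigma> p) \<noteq> 0" if "p \<in> K" for p
    using g0 \<sigma>(1)[OF that] by blast
  (* a subinterval of J on which u o exp is constant is carried by multiplication with a fixed
     f s to an interval on which \<Phi> is constant *)
  have U_phil: "\<not> U constant_on T" if T: "T \<subseteq> J" "proper_interval T" for T
  proof
    assume "U constant_on T"
    then obtain c where c: "\<And>y. y \<in> T \<Longrightarrow> U y = c" unfolding constant_on_def by blast
    obtain p where "p \<in> K" using K by (auto simp: proper_interval_def)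
    define T' where "T' = (\<lambda>y. exp p * exp y) ` T"
    have "T' \<subseteq> D"
      using D[OF \<sigma>(1)[OF \<open>p \<in> K\<close>]] \<sigma>(2)[OF \<open>p \<in> K\<close>] exp_I T(1) by (force simp: T'_def)
    moreover have "proper_interval T'"
      unfolding T'_def by (intro proper_interval_image T continuous_intros) (simp add: inj_on_def)
    moreover have "\<Phi> constant_on T'"
      unfolding constant_on_def
    proof (intro exI ballI)
      fix z assume "z \<in> T'"
      then obtain y where "y \<in> T" "z = exp (p + y)" by (auto simp: T'_def exp_add)
      then show "\<Phi> z = g (\<sigma> p) * (c + V p)"
        using eq[OF \<open>p \<in> K\<close>, of y] c T(1) by (auto simp: \<phi>_def)
    qed
    ultimately show False using phil unfolding philandering_on_def D_def by blast
  qed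
  have meas_K: "(\<lambda>p. \<phi> (p + y)) \<in> borel_measurable (lebesgue_on K)" if "y \<in> J" for y
  proof -
    have "(\<lambda>p. \<Phi> (exp y * exp p)) \<in> borel_measurable (lebesgue_on K)"
    proof (rule borel_measurable_in_log_coordinate[OF meas[folded D_def]])
      show "exp y * exp p \<in> D" if "p \<in> K" for p
        using D[OF \<sigma>(1)[OF that] exp_I[OF \<open>y \<in> J\<close>]] \<sigma>(2)[OF that] by (simp add: mult.commute)
    qed (use K in \<open>auto simp: proper_interval_def\<close>)
    then show ?thesis by (simp add: \<phi>_def exp_add mult.commute)
  qed
  have meas_J: "(\<lambda>y. \<phi> (p + y)) \<in> borel_measurable (lebesgue_on J)" if "p \<in> K" for p
  proof -
    have "(\<lambda>y. \<Phi> (exp p * exp y)) \<in> borel_measurable (lebesgue_on J)"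
    proof (rule borel_measurable_in_log_coordinate[OF meas[folded D_def]])
      show "exp p * exp y \<in> D" if "y \<in> J" for y
        using D[OF \<sigma>(1)[OF \<open>p \<in> K\<close>] exp_I[OF that]] \<sigma>(2)[OF \<open>p \<in> K\<close>] by simp
    qed (use J in \<open>auto simp: proper_interval_def\<close>)
    then show ?thesis by (simp add: \<phi>_def exp_add)
  qed
  have I_pos: "x > 0" if "x \<in> I" for x using that I(2) by auto
  show ?thesis
  proof (rule additive_separation[where \<phi> = \<phi> and U = U and V = V and J = J and K = K
        and G = "\<lambda>p. g (\<sigma> p)"])
    fix \<alpha> \<beta> \<gamma> :: real
    assume "\<alpha> \<noteq> 0" and U: "\<And>y. y \<in> J \<Longrightarrow> U y = \<alpha> * y + \<beta>"
      and V: "\<And>p. p \<in> K \<Longrightarrow> V p = \<alpha> * p + \<gamma>"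
    show ?thesis
    proof (intro disjI1 exI conjI ballI)
      fix x s assume xs: "x \<in> I" "s \<in> S"
      then have "ln (f s * x) = ln (f s) + ln x"
        using I_pos f_pos by (intro ln_mult_pos) auto
      then show "\<xi> s x = \<alpha> * ln (f s * x) + \<beta> + \<gamma>"
        using sep u v U V xs by (simp add: distrib_left)
    qed (use \<open>\<alpha> \<noteq> 0\<close> u v U V in auto)
  next
    fix \<alpha> \<beta> \<gamma> \<rho> :: real
    assume "\<alpha> \<noteq> 0" "\<rho> \<noteq> 0" and U: "\<And>y. y \<in> J \<Longrightarrow> U y = \<alpha> * exp (\<rho> * y) - \<beta>"
      and V: "\<And>p. p \<in> K \<Longrightarrow> V p = \<gamma> * exp (- \<rho> * p) + \<beta>"
    have u': "u x = \<alpha> * x powr \<rho> - \<beta>" if "x \<in> I" for x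
      using u[OF that] U I_pos[OF that] by (simp add: powr_def)
    have v': "v s = \<gamma> / f s powr \<rho> + \<beta>" if "s \<in> S" for s
      using v[OF that] V f_pos that by (auto simp: powr_def exp_minus divide_inverse)
    show ?thesis
      by (intro disjI2 exI[of _ \<alpha>] exI[of _ \<beta>] exI[of _ \<gamma>] exI[of _ \<rho>])
        (use \<open>\<alpha> \<noteq> 0\<close> \<open>\<rho> \<noteq> 0\<close> u' v' sep in simp)
  qed (fact J K eq g U_phil meas_K meas_J)+
qed

end
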